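(* Let $G$ be a Lie group acting smoothly on $\mathbb{R}^n$ and let $f:\mathbb{R}^n\to\mathbb{R}\cup\{\infty\}$ be invariant under this action (i.e. $f(gx)=f(x)$ for all $g\in G$, $x\in\mathbb{R}^n$). If $f$ is Lipschitz continuous near a point $\overline{x}\in\mathrm{int}\,\mathrm{dom} f$, then $$P_{T_{\overline{x}}G\overline{x}}\,\partial f(\overline{x})=\{0\}.$$
   Context: Smooth means $C^k$ for some fixed $k\in\{1,2,\dots,\infty\}$. $\mathrm{dom} f=\{x:f(x)<\infty\}$ and $\mathrm{int}$ denotes the interior. $f$ is Lipschitz continuous near $\overline{x}$ if there is $L>0$ with $|f(x)-f(y)|\le L|x-y|$ for $x,y\in\mathrm{dom} f$ near $\overline{x}$. For a set $S$ and a subspace $V$, $P_VS=\{P_Vs:s\in S\}$ with $P_V$ the orthogonal projection onto $V$. The orbit $Gx=\{gx:g\in G\}$ is an immersed submanifold; with $\theta^{(x)}(g)=gx$, its tangent space at $x$ is $T_xGx=\mathrm{Im}\,d(\theta^{(x)})_e\subseteq\mathbb{R}^n$. Subdifferential, at a point $\overline{x}$ where $f$ is finite: $\widehat\partial f(\overline{x})=\{v: f(x)\ge f(\overline{x})+\langle v,x-\overline{x}\rangle+o(|x-\overline{x}|)\text{ near }\overline{x}\}$; $\partial f(\overline{x})$ is the set of $v$ for which there are $x_k$ and $v_k\in\widehat\partial f(x_k)$ with $(x_k,f(x_k),v_k)\to(\overline{x},f(\overline{x}),v)$. *)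

theory Defs
  imports
    "HOL-Analysis.Analysis"
    "HOL-Library.Landau_Symbols"
    "HOL-Algebra.Group_Action"
begin

section \<open>Maps of class \<open>C\<^sup>k\<close>\<close>

text \<open>
  Differentiability classes on a set \<open>S\<close> that is relatively open in a linear subspace \<open>E\<close>
  of a Euclidean space. Working in a subspace instead of the whole type makes \<open>\<real>\<^sup>0\<close> available
  as a model space (every Euclidean space type has positive dimension), so that discrete
  groups are included among the Lie groups below.

  The derivative within \<open>S\<close> is determined only on \<open>E\<close> (see \<open>derivative_unique_on_subspace\<close>),
  hence only directions in \<open>E\<close> are ever used.
\<close>

primrec ck_nat_on ::
  "'a::euclidean_space set \<Rightarrow> nat \<Rightarrow> 'a set \<Rightarrow> ('a \<Rightarrow> 'b::euclidean_space) \<Rightarrow> bool" where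
  "ck_nat_on E 0 S f \<longleftrightarrow> continuous_on S f"
| "ck_nat_on E (Suc m) S f \<longleftrightarrow>
     (\<forall>x\<in>S. f differentiable (at x within S)) \<and>
     (\<forall>v\<in>E. ck_nat_on E m S (\<lambda>x. frechet_derivative f (at x within S) v))"

definition ck_on ::
  "'a::euclidean_space set \<Rightarrow> enat \<Rightarrow> 'a set \<Rightarrow> ('a \<Rightarrow> 'b::euclidean_space) \<Rightarrow> bool" where
  "ck_on E k S f \<longleftrightarrow> (\<forall>m. enat m \<le> k \<longrightarrow> ck_nat_on E m S f)"

lemma derivative_unique_on_subspace:
  fixes f :: "'a::euclidean_space \<Rightarrow> 'b::real_normed_vector"
  assumes E: "subspace E" "openin (top_of_set E) S" and x: "x \<in> S" and w: "w \<in> E"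
    and D1: "(f has_derivative D1) (at x within S)"
    and D2: "(f has_derivative D2) (at x within S)"
  shows "D1 w = D2 w"
proof -
  have xE: "x \<in> E" using E(2) x openin_imp_subset by blast
  obtain e where e: "e > 0" "\<And>y. y \<in> E \<Longrightarrow> dist y x < e \<Longrightarrow> y \<in> S"
    using E(2) x unfolding openin_euclidean_subtopology_iff by blast
  define d where "d = e / (norm w + 1)"
  have d: "d > 0" unfolding d_def using e(1) by (simp add: add_nonneg_pos)
  define T where "T = ball (0::real) d"
  have inS: "x + t *\<^sub>R w \<in> S" if "t \<in> T" for t
  proof (rule e(2))
    show "x + t *\<^sub>R w \<in> E" using E(1) xE w by (simp add: subspace_add subspace_scale)
    have "\<bar>t\<bar> < d" using that by (simp add: T_def)
    then have "\<bar>t\<bar> * (norm w + 1) < e"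
      unfolding d_def by (simp add: pos_less_divide_eq add_nonneg_pos)
    moreover have "\<bar>t\<bar> * norm w \<le> \<bar>t\<bar> * (norm w + 1)" by (simp add: mult_left_mono)
    ultimately show "dist (x + t *\<^sub>R w) x < e" by (simp add: dist_norm)
  qed
  have line: "((\<lambda>t. x + t *\<^sub>R w) has_derivative (\<lambda>t. t *\<^sub>R w)) (at 0 within T)"
    by (auto intro!: derivative_eq_intros)
  have comp: "((\<lambda>t. f (x + t *\<^sub>R w)) has_derivative (\<lambda>t. D (t *\<^sub>R w))) (at 0)"
    if "(f has_derivative D) (at x within S)" for D
  proof -
    have "(f has_derivative D) (at (x + 0 *\<^sub>R w) within (\<lambda>t. x + t *\<^sub>R w) ` T)"
      using that inS by (auto intro: has_derivative_subset)
    from diff_chain_within[OF line this]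
    have "((\<lambda>t. f (x + t *\<^sub>R w)) has_derivative (\<lambda>t. D (t *\<^sub>R w))) (at 0 within T)"
      by (simp add: o_def)
    then show ?thesis using d at_within_open[of 0 T] by (simp add: T_def)
  qed
  have "(\<lambda>t. D1 (t *\<^sub>R w)) = (\<lambda>t. D2 (t *\<^sub>R w))"
    using has_derivative_unique[OF comp[OF D1] comp[OF D2]] .
  from fun_cong[OF this, of 1] show ?thesis by simp
qed


section \<open>Manifolds\<close>

text \<open>
  A chart is a pair of a coordinate domain \<open>U\<close> and a coordinate map. The coordinate map is a
  total function, of which only the values on \<open>U\<close> matter. The dimension of the manifold is
  that of the linear subspace \<open>model M\<close>. The atlas need not be maximal.
\<close>

record ('p, 'e) manifold =
  mtop :: "'p topology"
  model :: "'e set"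
  atlas :: "('p set \<times> ('p \<Rightarrow> 'e)) set"

definition ck_manifold :: "enat \<Rightarrow> ('p, 'e::euclidean_space) manifold \<Rightarrow> bool" where
  "ck_manifold k M \<longleftrightarrow>
     Hausdorff_space (mtop M) \<and> second_countable (mtop M) \<and> subspace (model M) \<and>
     \<Union> (fst ` atlas M) = topspace (mtop M) \<and>
     (\<forall>(U, \<phi>)\<in>atlas M.
        openin (mtop M) U \<and> openin (top_of_set (model M)) (\<phi> ` U) \<and>
        homeomorphic_map (subtopology (mtop M) U) (top_of_set (\<phi> ` U)) \<phi>) \<and>
     (\<forall>(U, \<phi>)\<in>atlas M. \<forall>(V, \<psi>)\<in>atlas M.
        ck_on (model M) k (\<phi> ` (U \<inter> V)) (\<psi> \<circ> inv_into U \<phi>))"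

definition ck_map ::
  "enat \<Rightarrow> ('p, 'd::euclidean_space) manifold \<Rightarrow> ('q, 'e::euclidean_space) manifold \<Rightarrow>
   ('p \<Rightarrow> 'q) \<Rightarrow> bool" where
  "ck_map k M N F \<longleftrightarrow>
     continuous_map (mtop M) (mtop N) F \<and>
     (\<forall>(U, \<phi>)\<in>atlas M. \<forall>(V, \<psi>)\<in>atlas N.
        ck_on (model M) k (\<phi> ` {p \<in> U. F p \<in> V}) (\<psi> \<circ> F \<circ> inv_into U \<phi>))"

definition prod_manifold ::
  "('p, 'd) manifold \<Rightarrow> ('q, 'e) manifold \<Rightarrow> ('p \<times> 'q, 'd \<times> 'e) manifold" where
  "prod_manifold M N =
     \<lparr>mtop = prod_topology (mtop M) (mtop N),
      model = model M \<times> model N,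
      atlas = {(U \<times> V, map_prod \<phi> \<psi>) | U \<phi> V \<psi>. (U, \<phi>) \<in> atlas M \<and> (V, \<psi>) \<in> atlas N}\<rparr>"

definition euclidean_manifold :: "('e::euclidean_space, 'e) manifold" where
  "euclidean_manifold = \<lparr>mtop = euclidean, model = UNIV, atlas = {(UNIV, id)}\<rparr>"

text \<open>
  The image of the differential at \<open>p\<close> of a map \<open>F\<close> into a Euclidean space: a tangent vector
  at \<open>p\<close> is given by a vector \<open>w\<close> of the model space in a chart around \<open>p\<close>, and is mapped to
  the derivative in direction \<open>w\<close> of \<open>F\<close> read in that chart. By \<open>differential_image_chart\<close>
  below, each single chart around \<open>p\<close> already yields the whole image.
\<close>

definition differential_image_in_chart ::
  "('p, 'd::euclidean_space) manifold \<Rightarrow> 'p set \<times> ('p \<Rightarrow> 'd) \<Rightarrow> ('p \<Rightarrow> 'b::euclidean_space) \<Rightarrow>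
   'p \<Rightarrow> 'b set" where
  "differential_image_in_chart M c F p =
     (case c of (U, \<phi>) \<Rightarrow>
        frechet_derivative (F \<circ> inv_into U \<phi>) (at (\<phi> p) within \<phi> ` U) ` model M)"

definition differential_image ::
  "('p, 'd::euclidean_space) manifold \<Rightarrow> ('p \<Rightarrow> 'b::euclidean_space) \<Rightarrow> 'p \<Rightarrow> 'b set" where
  "differential_image M F p =
     (\<Union>c\<in>{c \<in> atlas M. p \<in> fst c}. differential_image_in_chart M c F p)"

lemma ck_manifold_chartD:
  assumes "ck_manifold k M" and "(U, \<phi>) \<in> atlas M"
  shows "openin (mtop M) U" and "openin (top_of_set (model M)) (\<phi> ` U)"
    and "homeomorphic_map (subtopology (mtop M) U) (top_of_set (\<phi> ` U)) \<phi>"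
  using assms unfolding ck_manifold_def by (blast dest: bspec)+

lemma ck_manifold_chart_inj_on:
  assumes "ck_manifold k M" and "(U, \<phi>) \<in> atlas M"
  shows "inj_on \<phi> U"
  using homeomorphic_imp_injective_map[OF ck_manifold_chartD(3)[OF assms]]
    openin_subset[OF ck_manifold_chartD(1)[OF assms]]
  by (simp add: Int_absorb1)

lemma ck_manifold_transitionD:
  assumes "ck_manifold k M" and "(U, \<phi>) \<in> atlas M" and "(V, \<psi>) \<in> atlas M"
  shows "ck_on (model M) k (\<phi> ` (U \<inter> V)) (\<psi> \<circ> inv_into U \<phi>)"
  using assms unfolding ck_manifold_def by (blast dest: bspec)

lemma chart_overlap_openin:
  assumes M: "ck_manifold k M" and c1: "(U, \<phi>) \<in> atlas M" and c2: "(V, \<psi>) \<in> atlas M"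
  shows "openin (top_of_set (\<phi> ` U)) (\<phi> ` (U \<inter> V))"
proof -
  have hm: "homeomorphic_map (subtopology (mtop M) U) (top_of_set (\<phi> ` U)) \<phi>"
    and oV: "openin (mtop M) V"
    using ck_manifold_chartD[OF M c1] ck_manifold_chartD[OF M c2] by simp_all
  have "openin (subtopology (mtop M) U) (U \<inter> V)"
    using oV openin_subtopology_Int2 by blast
  then show ?thesis
    using homeomorphic_imp_open_map[OF hm] unfolding open_map_def by blast
qed

lemma differential_image_in_chart_subset:
  fixes M :: "('p, 'd::euclidean_space) manifold" and F :: "'p \<Rightarrow> 'b::euclidean_space"
  assumes M: "ck_manifold k M" and k: "k \<ge> 1" and F: "ck_map k M euclidean_manifold F"
    and c1: "(U, \<phi>) \<in> atlas M" "p \<in> U" and c2: "(V, \<psi>) \<in> atlas M" "p \<in> V"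
  shows "differential_image_in_chart M (U, \<phi>) F p \<subseteq> differential_image_in_chart M (V, \<psi>) F p"
proof
  fix b assume "b \<in> differential_image_in_chart M (U, \<phi>) F p"
  let ?E = "model M"
  define W where "W = \<phi> ` (U \<inter> V)"
  have E: "subspace ?E" using M by (simp add: ck_manifold_def)
  have oU: "openin (top_of_set ?E) (\<phi> ` U)" and oV: "openin (top_of_set ?E) (\<psi> ` V)"
    using ck_manifold_chartD[OF M c1(1)] ck_manifold_chartD[OF M c2(1)] by simp_all
  have inj: "inj_on \<phi> U" "inj_on \<psi> V"
    using ck_manifold_chart_inj_on[OF M] c1(1) c2(1) by blast+
  from chart_overlap_openin[OF M c1(1) c2(1)] have "openin (top_of_set (\<phi> ` U)) W"
    by (simp add: W_def)
  then have oW: "openin (top_of_set ?E) W" using oU openin_trans by blast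
  have pW: "\<phi> p \<in> W" using c1 c2 by (simp add: W_def)
  have WU: "W \<subseteq> \<phi> ` U" by (auto simp: W_def)
  have one: "enat (Suc 0) \<le> k" using k by (simp add: one_enat_def)
  have Fdiff: "(F \<circ> inv_into S f) differentiable (at (f p) within f ` S)"
    if "(S, f) \<in> atlas M" "p \<in> S" for S f
  proof -
    have "ck_on ?E k (f ` S) (F \<circ> inv_into S f)"
      using F that(1) unfolding ck_map_def euclidean_manifold_def by (auto dest!: bspec)
    then have "ck_nat_on ?E (Suc 0) (f ` S) (F \<circ> inv_into S f)" using one by (simp only: ck_on_def)
    then show ?thesis using that(2) by simp
  qed
  have "ck_on ?E k W (\<psi> \<circ> inv_into U \<phi>)"
    unfolding W_def by (rule ck_manifold_transitionD[OF M c1(1) c2(1)])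
  then have "ck_nat_on ?E (Suc 0) W (\<psi> \<circ> inv_into U \<phi>)" using one by (simp only: ck_on_def)
  then have "(\<psi> \<circ> inv_into U \<phi>) differentiable (at (\<phi> p) within W)" using pW by simp
  then obtain T where T: "((\<psi> \<circ> inv_into U \<phi>) has_derivative T) (at (\<phi> p) within W)"
    unfolding differentiable_def by blast
  let ?DU = "frechet_derivative (F \<circ> inv_into U \<phi>) (at (\<phi> p) within \<phi> ` U)"
  let ?DV = "frechet_derivative (F \<circ> inv_into V \<psi>) (at (\<psi> p) within \<psi> ` V)"
  from \<open>b \<in> _\<close> obtain w where w: "w \<in> ?E" "b = ?DU w"
    by (auto simp: differential_image_in_chart_def)
  have trans: "(\<psi> \<circ> inv_into U \<phi>) ` W \<subseteq> \<psi> ` V"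
    using inj by (auto simp: W_def)
  have pp: "(\<psi> \<circ> inv_into U \<phi>) (\<phi> p) = \<psi> p" using inj c1 by simp
  have "((F \<circ> inv_into U \<phi>) has_derivative ?DU) (at (\<phi> p) within W)"
    using Fdiff[OF c1] WU has_derivative_subset by (metis frechet_derivative_works)
  moreover have "((F \<circ> inv_into U \<phi>) has_derivative (?DV \<circ> T)) (at (\<phi> p) within W)"
  proof -
    have "((F \<circ> inv_into V \<psi>) has_derivative ?DV) (at (\<psi> p) within (\<psi> \<circ> inv_into U \<phi>) ` W)"
      using Fdiff[OF c2] trans has_derivative_subset by (metis frechet_derivative_works)
    then have "((F \<circ> inv_into V \<psi> \<circ> (\<psi> \<circ> inv_into U \<phi>)) has_derivative (?DV \<circ> T)) (at (\<phi> p) within W)"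
      using diff_chain_within[OF T] pp by simp
    then show ?thesis
      by (rule has_derivative_transform[OF pW, rotated]) (use inj in \<open>auto simp: W_def\<close>)
  qed
  ultimately have "?DU w = (?DV \<circ> T) w"
    by (rule derivative_unique_on_subspace[OF E oW pW w(1)])
  moreover have "T w \<in> ?E"
  proof -
    have "y \<bullet> T w = 0" if y: "y \<in> orthogonal_comp ?E" for y
    proof -
      have "((\<lambda>u. y \<bullet> (\<psi> \<circ> inv_into U \<phi>) u) has_derivative (\<lambda>h. y \<bullet> T h)) (at (\<phi> p) within W)"
        using T by (rule has_derivative_inner_right)
      moreover have "0 = y \<bullet> (\<psi> \<circ> inv_into U \<phi>) u" if "u \<in> W" for u
      proof -
        have "(\<psi> \<circ> inv_into U \<phi>) u \<in> ?E" using that trans oV openin_imp_subset by blast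
        then have "(\<psi> \<circ> inv_into U \<phi>) u \<bullet> y = 0"
          using y unfolding orthogonal_comp_def orthogonal_def by blast
        then show ?thesis by (simp only: inner_commute)
      qed
      ultimately have "((\<lambda>u. 0) has_derivative (\<lambda>h. y \<bullet> T h)) (at (\<phi> p) within W)"
        by (rule has_derivative_transform[OF pW, rotated])
      from derivative_unique_on_subspace[OF E oW pW w(1) this has_derivative_const]
      show ?thesis .
    qed
    then have "T w \<in> orthogonal_comp (orthogonal_comp ?E)"
      unfolding orthogonal_comp_def[of "orthogonal_comp ?E"] orthogonal_def by blast
    then show ?thesis using orthogonal_comp_self[OF E] by simp
  qed
  ultimately show "b \<in> differential_image_in_chart M (V, \<psi>) F p"
    unfolding differential_image_in_chart_def using w(2) by (simp add: image_eqI)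
qed

lemma differential_image_chart:
  fixes M :: "('p, 'd::euclidean_space) manifold" and F :: "'p \<Rightarrow> 'b::euclidean_space"
  assumes "ck_manifold k M" and "k \<ge> 1" and "ck_map k M euclidean_manifold F"
    and "c \<in> atlas M" "p \<in> fst c"
  shows "differential_image M F p = differential_image_in_chart M c F p"
proof -
  have "differential_image_in_chart M c' F p \<subseteq> differential_image_in_chart M c F p"
    if "c' \<in> atlas M" "p \<in> fst c'" for c'
    using differential_image_in_chart_subset[OF assms(1-3), of "fst c'" "snd c'" p "fst c" "snd c"]
      that assms(4,5) by simp
  then show ?thesis using assms(4,5) unfolding differential_image_def by blast
qed


section \<open>Lie groups and smooth actions\<close>

text \<open>
  All structure is of class \<open>C\<^sup>k\<close>; every \<open>C\<^sup>\<infinity>\<close> Lie group is a Lie group in this sense.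
\<close>

definition lie_group ::
  "enat \<Rightarrow> ('g, 'm) monoid_scheme \<Rightarrow> ('g, 'e::euclidean_space) manifold \<Rightarrow> bool" where
  "lie_group k G M \<longleftrightarrow>
     group G \<and> ck_manifold k M \<and> topspace (mtop M) = carrier G \<and>
     ck_map k (prod_manifold M M) M (\<lambda>(a, b). a \<otimes>\<^bsub>G\<^esub> b) \<and>
     ck_map k M M (\<lambda>a. inv\<^bsub>G\<^esub> a)"

definition smooth_action ::
  "enat \<Rightarrow> ('g, 'm) monoid_scheme \<Rightarrow> ('g, 'e::euclidean_space) manifold \<Rightarrow>
   ('g \<Rightarrow> 'a::euclidean_space \<Rightarrow> 'a) \<Rightarrow> bool" where
  "smooth_action k G M \<theta> \<longleftrightarrow>
     group_action G UNIV \<theta> \<and>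
     ck_map k (prod_manifold M euclidean_manifold) euclidean_manifold (\<lambda>(g, x). \<theta> g x)"

definition orbit_tangent_space ::
  "('g, 'm) monoid_scheme \<Rightarrow> ('g, 'e::euclidean_space) manifold \<Rightarrow>
   ('g \<Rightarrow> 'a::euclidean_space \<Rightarrow> 'a) \<Rightarrow> 'a \<Rightarrow> 'a set" where
  "orbit_tangent_space G M \<theta> x = differential_image M (\<lambda>g. \<theta> g x) \<one>\<^bsub>G\<^esub>"


section \<open>Variational notions\<close>

definition effective_domain :: "('a \<Rightarrow> ereal) \<Rightarrow> 'a set" where
  "effective_domain f = {x. f x < \<infinity>}"

definition lipschitz_near :: "('a::euclidean_space \<Rightarrow> ereal) \<Rightarrow> 'a \<Rightarrow> bool" where
  "lipschitz_near f xbar \<longleftrightarrow>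
     (\<exists>L>0. \<exists>\<epsilon>>0. \<forall>x \<in> effective_domain f \<inter> ball xbar \<epsilon>. \<forall>y \<in> effective_domain f \<inter> ball xbar \<epsilon>.
        \<bar>f x - f y\<bar> \<le> ereal (L * norm (x - y)))"

definition regular_subdifferential :: "('a::euclidean_space \<Rightarrow> ereal) \<Rightarrow> 'a \<Rightarrow> 'a set" where
  "regular_subdifferential f xbar =
     {v. \<bar>f xbar\<bar> \<noteq> \<infinity> \<and>
         (\<exists>r :: 'a \<Rightarrow> real. r \<in> o[at xbar](\<lambda>x. norm (x - xbar)) \<and>
            (\<forall>\<^sub>F x in at xbar. f x \<ge> f xbar + ereal (v \<bullet> (x - xbar)) + ereal (r x)))}"

definition limiting_subdifferential :: "('a::euclidean_space \<Rightarrow> ereal) \<Rightarrow> 'a \<Rightarrow> 'a set" where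
  "limiting_subdifferential f xbar =
     {v. \<bar>f xbar\<bar> \<noteq> \<infinity> \<and>
         (\<exists>X V. (\<forall>j::nat. V j \<in> regular_subdifferential f (X j)) \<and>
            X \<longlonglongrightarrow> xbar \<and> (\<lambda>j. f (X j)) \<longlonglongrightarrow> f xbar \<and> V \<longlonglongrightarrow> v)}"

definition orthogonal_projection :: "'a::euclidean_space set \<Rightarrow> 'a \<Rightarrow> 'a" where
  "orthogonal_projection V s = (THE p. p \<in> V \<and> (\<forall>w\<in>V. orthogonal (s - p) w))"

end

theory Submission
  imports Defs
begin

text \<open>
  Two facts have to be shown: every limiting subgradient at \<open>xbar\<close> is orthogonal to the tangent
  space of the orbit, and there is at least one limiting subgradient.

  Orthogonality is first shown for regular subgradients. Along a curve inside an orbit the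
  function \<open>f\<close> is constant, so a regular subgradient \<open>v\<close> at \<open>x\<close> turns the velocity \<open>d\<close> of such a
  curve through \<open>x\<close> into a derivative at a local maximum, whence \<open>v \<bullet> d = 0\<close>
  (\<open>regular_subgradient_orthogonal_curve\<close>). The velocity at \<open>x\<close> generated by a fixed direction in a
  chart of the group depends continuously on \<open>x\<close>, because the action is \<open>C\<^sup>1\<close> jointly in the group
  element and the point (\<open>orbit_map_derivative_continuous\<close>). The relation \<open>v \<bullet> d = 0\<close> therefore
  survives the passage to limiting subgradients. Dimension jumps of the orbits near \<open>xbar\<close> are
  harmless, since only velocities generated by a fixed direction are compared.

  Existence rests on the Lipschitz condition. Minimizing \<open>f + \<lambda> |\<cdot> - xbar|\<^sup>2\<close> over a small ball
  produces points that tend to \<open>xbar\<close> as \<open>\<lambda>\<close> grows. Once such a point is interior to the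
  ball, the negative gradient of the penalty there is a regular subgradient, of norm at most
  \<open>2 * L\<close> for a Lipschitz constant \<open>L\<close>. A convergent
  subsequence of these subgradients has a limiting subgradient as its limit
  (\<open>limiting_subdifferential_nonempty\<close>).
\<close>

section \<open>Existence of limiting subgradients\<close>

lemma lipschitz_near_finite_on_ball:
  fixes f :: "'a::euclidean_space \<Rightarrow> ereal"
  assumes "\<And>x. f x \<noteq> -\<infinity>" and "xbar \<in> interior (effective_domain f)" and "lipschitz_near f xbar"
  obtains L e g where "L > 0" and "e > 0" and "\<And>x. x \<in> ball xbar e \<Longrightarrow> f x = ereal (g x)"
    and "L-lipschitz_on (ball xbar e) g"
proof -
  obtain L e1 where L: "L > 0" and e1: "e1 > 0"
    and lip: "\<And>x y. \<lbrakk>x \<in> effective_domain f \<inter> ball xbar e1; y \<in> effective_domain f \<inter> ball xbar e1\<rbrakk>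
      \<Longrightarrow> \<bar>f x - f y\<bar> \<le> ereal (L * norm (x - y))"
    using assms(3) unfolding lipschitz_near_def by blast
  obtain e2 where e2: "e2 > 0" "ball xbar e2 \<subseteq> effective_domain f"
    using assms(2) unfolding mem_interior by blast
  define e where "e = min e1 e2"
  define g where "g x = real_of_ereal (f x)" for x
  have fg: "f x = ereal (g x)" if "x \<in> ball xbar e" for x
  proof -
    have "x \<in> effective_domain f" using that e2 by (auto simp: e_def)
    then have "\<bar>f x\<bar> \<noteq> \<infinity>" using assms(1)[of x] by (auto simp: effective_domain_def)
    then show ?thesis by (simp add: g_def ereal_real')
  qed
  have "dist (g x) (g y) \<le> L * dist x y" if "x \<in> ball xbar e" "y \<in> ball xbar e" for x y
    using lip[of x y] that e2(2) fg[OF that(1)] fg[OF that(2)]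
    by (auto simp: e_def dist_norm subset_iff)
  then have "L-lipschitz_on (ball xbar e) g" using L by (intro lipschitz_onI) auto
  with L e1 e2(1) fg show ?thesis by (intro that[of L e g]) (auto simp: e_def)
qed

text \<open>
  A quadratic minorant is the form in which the penalized minimization delivers regular
  subgradients: its second-order error is of order \<open>o(norm (y - x))\<close>.
\<close>

lemma proximal_subgradient_regular:
  fixes f :: "'a::euclidean_space \<Rightarrow> ereal"
  assumes "\<bar>f x\<bar> \<noteq> \<infinity>"
    and "\<forall>\<^sub>F y in at x. f y \<ge> f x + ereal (v \<bullet> (y - x)) + ereal (- c * (norm (y - x))\<^sup>2)"
  shows "v \<in> regular_subdifferential f x"
proof -
  have "((\<lambda>y. - c * norm (y - x)) \<longlongrightarrow> - c * norm (x - x)) (at x)"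
    by (intro tendsto_intros)
  then have lim: "((\<lambda>y. - c * norm (y - x)) \<longlongrightarrow> 0) (at x)" by simp
  have "\<forall>\<^sub>F y in at x. - c * norm (y - x) = (- c * (norm (y - x))\<^sup>2) / norm (y - x)"
    by (simp add: eventually_at_filter power2_eq_square)
  with lim have "((\<lambda>y. (- c * (norm (y - x))\<^sup>2) / norm (y - x)) \<longlongrightarrow> 0) (at x)"
    by (rule Lim_transform_eventually)
  then have "(\<lambda>y. - c * (norm (y - x))\<^sup>2) \<in> o[at x](\<lambda>y. norm (y - x))"
    by (rule smalloI_tendsto) (simp add: eventually_at_filter)
  then show ?thesis using assms unfolding regular_subdifferential_def by blast
qed

text \<open>
  The penalized minimizer \<open>x\<close> satisfies \<open>c * norm (x - xbar)\<^sup>2 \<le> L * norm (x - xbar)\<close>, since \<open>xbar\<close>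
  is a competitor. This confines \<open>x\<close> to a small ball, so that it is an unconstrained local minimizer
  once \<open>c\<close> is large, and it also bounds the gradient of the penalty independently of \<open>c\<close>.
\<close>

lemma bounded_regular_subgradient_near:
  fixes f :: "'a::euclidean_space \<Rightarrow> ereal"
  assumes e: "e > 0" and fg: "\<And>x. x \<in> ball xbar e \<Longrightarrow> f x = ereal (g x)"
    and lip: "L-lipschitz_on (ball xbar e) g" and c: "c > 0" and ce: "L / c < e / 2"
  obtains x v where "v \<in> regular_subdifferential f x" and "norm (x - xbar) \<le> L / c"
    and "norm v \<le> 2 * L"
proof -
  have L: "L \<ge> 0" using lip by (rule lipschitz_on_nonneg)
  define h where "h x = g x + c * (norm (x - xbar))\<^sup>2" for x
  have sub: "cball xbar (e/2) \<subseteq> ball xbar e" using e by auto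
  have "continuous_on (cball xbar (e/2)) g"
    using lipschitz_on_continuous_on[OF lip] sub continuous_on_subset by blast
  then have "continuous_on (cball xbar (e/2)) h"
    unfolding h_def by (intro continuous_intros)
  moreover have "cball xbar (e/2) \<noteq> {}" using e by simp
  ultimately obtain x where x: "x \<in> cball xbar (e/2)"
    and min: "\<And>y. y \<in> cball xbar (e/2) \<Longrightarrow> h x \<le> h y"
    using continuous_attains_inf[OF compact_cball] by blast
  let ?n = "norm (x - xbar)"
  have xb: "x \<in> ball xbar e" using x sub by blast
  have "h x \<le> h xbar" using e by (intro min) simp
  then have "c * ?n\<^sup>2 \<le> g xbar - g x" by (simp add: h_def)
  also have "\<dots> \<le> L * ?n"
    using lipschitz_onD[OF lip, of xbar x] xb e by (simp add: dist_norm norm_minus_commute)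
  finally have *: "(c * ?n) * ?n \<le> L * ?n" by (simp add: power2_eq_square mult.assoc)
  have cn: "c * ?n \<le> L"
  proof (cases "?n = 0")
    case True then show ?thesis using L by simp
  next
    case False then show ?thesis using * by (simp add: mult_le_cancel_right)
  qed
  then have n: "?n \<le> L / c" using c by (simp add: field_simps)
  define v where "v = (- 2 * c) *\<^sub>R (x - xbar)"
  have "norm v \<le> 2 * L" using cn c by (simp add: v_def)
  moreover have "v \<in> regular_subdifferential f x"
  proof (rule proximal_subgradient_regular[where c = c])
    show "\<bar>f x\<bar> \<noteq> \<infinity>" using fg[OF xb] by simp
    have "?n < e/2" using n ce by (rule le_less_trans)
    then have "x \<in> ball xbar (e/2)" by (simp only: mem_ball dist_norm norm_minus_commute)
    then have "\<forall>\<^sub>F y in at x. y \<in> ball xbar (e/2)"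
      by (intro eventually_at_in_open') auto
    then show "\<forall>\<^sub>F y in at x. f y \<ge> f x + ereal (v \<bullet> (y - x)) + ereal (- c * (norm (y - x))\<^sup>2)"
    proof eventually_elim
      case (elim y)
      then have yc: "y \<in> cball xbar (e/2)" by simp
      then have "h x \<le> h y" by (rule min)
      moreover have "(norm (y - xbar))\<^sup>2 = ?n\<^sup>2 + 2 * ((x - xbar) \<bullet> (y - x)) + (norm (y - x))\<^sup>2"
        unfolding power2_norm_eq_inner by (simp add: algebra_simps inner_commute)
      moreover have yb: "y \<in> ball xbar e" using yc sub by blast
      ultimately have "g y \<ge> g x + v \<bullet> (y - x) + (- c * (norm (y - x))\<^sup>2)"
        by (simp add: h_def v_def algebra_simps)
      then show ?case using fg[OF xb] fg[OF yb] by simp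
    qed
  qed
  ultimately show ?thesis using n that by blast
qed

lemma limiting_subdifferential_nonempty:
  fixes f :: "'a::euclidean_space \<Rightarrow> ereal"
  assumes "\<And>x. f x \<noteq> -\<infinity>" and "xbar \<in> interior (effective_domain f)" and "lipschitz_near f xbar"
  shows "limiting_subdifferential f xbar \<noteq> {}"
proof -
  obtain L e g where L: "L > 0" and e: "e > 0"
    and fg: "\<And>x. x \<in> ball xbar e \<Longrightarrow> f x = ereal (g x)"
    and lip: "L-lipschitz_on (ball xbar e) g"
    using lipschitz_near_finite_on_ball[OF assms] by blast
  (* The offset 2 * L / e makes the radius L / c j smaller than e / 2 for every j. *)
  define c where "c j = 2 * L / e + real (Suc j)" for j
  have c: "c j > 0" and ce: "L / c j < e / 2" for j
  proof -
    show "c j > 0" unfolding c_def using L e by (simp add: add_nonneg_pos)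
    have "2 * L < c j * e" unfolding c_def using e by (simp add: field_simps add_pos_nonneg)
    with \<open>c j > 0\<close> show "L / c j < e / 2" by (simp add: field_simps)
  qed
  have "\<exists>x v. v \<in> regular_subdifferential f x \<and> norm (x - xbar) \<le> L / c j \<and> norm v \<le> 2 * L" for j
    using bounded_regular_subgradient_near[OF e fg lip c ce] by metis
  then obtain X V where V: "\<And>j. V j \<in> regular_subdifferential f (X j)"
    and X: "\<And>j. norm (X j - xbar) \<le> L / c j" and VL: "\<And>j. norm (V j) \<le> 2 * L"
    by metis
  have "filterlim c at_top sequentially"
    unfolding c_def
    by (intro filterlim_tendsto_add_at_top[OF tendsto_const]
        filterlim_compose[OF filterlim_real_sequentially filterlim_Suc])
  then have "(\<lambda>j. L / c j) \<longlonglongrightarrow> 0"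
    by (intro tendsto_divide_0[OF tendsto_const] filterlim_at_top_imp_at_infinity)
  then have "(\<lambda>j. X j - xbar) \<longlonglongrightarrow> 0"
    by (rule Lim_null_comparison[OF always_eventually, rotated]) (simp add: X)
  then have Xlim: "X \<longlonglongrightarrow> xbar" by (rule LIM_zero_cancel)
  have Xb: "X j \<in> ball xbar e" for j
    using le_less_trans[OF X[of j] ce[of j]] e by (simp add: dist_norm norm_minus_commute)
  have "isCont g xbar"
    using lipschitz_on_continuous_on[OF lip] e by (simp add: continuous_on_eq_continuous_at)
  then have "(\<lambda>j. ereal (g (X j))) \<longlonglongrightarrow> ereal (g xbar)"
    using isCont_tendsto_compose[OF _ Xlim] by (intro tendsto_intros) blast
  then have fX: "(\<lambda>j. f (X j)) \<longlonglongrightarrow> f xbar" using fg Xb e by simp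
  have "bounded (range V)" using VL by (auto intro: boundedI)
  then obtain l r where r: "strict_mono r" and lim: "(V \<circ> r) \<longlonglongrightarrow> l"
    using bounded_imp_convergent_subsequence by blast
  have "l \<in> limiting_subdifferential f xbar"
    unfolding limiting_subdifferential_def
  proof (intro CollectI conjI exI)
    show "\<bar>f xbar\<bar> \<noteq> \<infinity>" using fg e by simp
    show "\<forall>j. (V \<circ> r) j \<in> regular_subdifferential f ((X \<circ> r) j)" using V by simp
    show "(X \<circ> r) \<longlonglongrightarrow> xbar" using Xlim r by (rule LIMSEQ_subseq_LIMSEQ)
    show "(\<lambda>j. f ((X \<circ> r) j)) \<longlonglongrightarrow> f xbar"
      using LIMSEQ_subseq_LIMSEQ[OF fX r] by (simp add: o_def)
  qed (rule lim)
  then show ?thesis by blast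
qed


section \<open>Subgradients and orbits\<close>

text \<open>
  The remainder of the regular subgradient inequality, set to zero at the base point, is
  differentiable there with derivative zero. Hence \<open>v \<bullet> (\<gamma> t - \<gamma> 0)\<close> plus the remainder at \<open>\<gamma> t\<close> has
  derivative \<open>v \<bullet> d\<close> at \<open>0\<close>, and it has a local maximum there.
\<close>

lemma regular_subgradient_orthogonal_curve:
  fixes f :: "'a::euclidean_space \<Rightarrow> ereal" and \<gamma> :: "real \<Rightarrow> 'a"
  assumes v: "v \<in> regular_subdifferential f (\<gamma> 0)"
    and \<gamma>: "(\<gamma> has_vector_derivative d) (at 0)"
    and inv: "\<forall>\<^sub>F t in at 0. f (\<gamma> t) \<le> f (\<gamma> 0)"
  shows "v \<bullet> d = 0"
proof -
  obtain r where fin: "\<bar>f (\<gamma> 0)\<bar> \<noteq> \<infinity>"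
    and r: "r \<in> o[at (\<gamma> 0)](\<lambda>x. norm (x - \<gamma> 0))"
    and ineq: "\<forall>\<^sub>F x in at (\<gamma> 0). f x \<ge> f (\<gamma> 0) + ereal (v \<bullet> (x - \<gamma> 0)) + ereal (r x)"
    using v unfolding regular_subdifferential_def by auto
  define s where "s x = (if x = \<gamma> 0 then 0 else r x)" for x
  have "((\<lambda>x. r x / norm (x - \<gamma> 0)) \<longlongrightarrow> 0) (at (\<gamma> 0))" using r by (rule smalloD_tendsto)
  then have "((\<lambda>x. s x / norm (x - \<gamma> 0)) \<longlongrightarrow> 0) (at (\<gamma> 0))"
    by (rule Lim_transform_eventually) (simp add: eventually_at_filter s_def)
  then have "((\<lambda>x. norm (s x - s (\<gamma> 0) - 0) / norm (x - \<gamma> 0)) \<longlongrightarrow> 0) (at (\<gamma> 0))"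
    by (subst (asm) tendsto_rabs_zero_iff[symmetric]) (simp add: s_def)
  then have s: "(s has_derivative (\<lambda>_. 0)) (at (\<gamma> 0))"
    by (simp add: has_derivative_iff_norm)
  define q where "q t = v \<bullet> (\<gamma> t - \<gamma> 0) + s (\<gamma> t)" for t
  have \<gamma>': "(\<gamma> has_derivative (\<lambda>t. t *\<^sub>R d)) (at 0)"
    using \<gamma> by (simp add: has_vector_derivative_def)
  have "(q has_derivative (\<lambda>t. v \<bullet> (t *\<^sub>R d - 0) + 0)) (at 0)"
    unfolding q_def
    by (intro has_derivative_add has_derivative_inner_right has_derivative_diff \<gamma>'
        has_derivative_const has_derivative_compose[OF \<gamma>' s])
  then have q: "(q has_real_derivative (v \<bullet> d)) (at 0)"
    by (simp add: has_field_derivative_def mult.commute[of _ "v \<bullet> d"] fun_eq_iff)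
  have "\<forall>\<^sub>F x in nhds (\<gamma> 0). f x \<ge> f (\<gamma> 0) + ereal (v \<bullet> (x - \<gamma> 0) + s x)"
    using ineq unfolding eventually_at_filter
    by eventually_elim (auto simp: s_def add.assoc simp flip: plus_ereal.simps(1) zero_ereal_def)
  moreover have "(\<gamma> \<longlongrightarrow> \<gamma> 0) (at 0)"
    using has_vector_derivative_continuous[OF \<gamma>] by (simp add: continuous_at)
  ultimately have "\<forall>\<^sub>F t in at 0. f (\<gamma> t) \<ge> f (\<gamma> 0) + ereal (q t)"
    unfolding q_def by (rule eventually_compose_filterlim)
  with inv have "\<forall>\<^sub>F t in at 0. q t \<le> q 0"
  proof eventually_elim
    case (elim t)
    then have "f (\<gamma> 0) + ereal (q t) \<le> f (\<gamma> 0)" by order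
    with fin show ?case by (cases "f (\<gamma> 0)") (auto simp: q_def s_def)
  qed
  then obtain b where b: "b > 0" "\<And>t. \<lbrakk>t \<noteq> 0; \<bar>t\<bar> < b\<rbrakk> \<Longrightarrow> q t \<le> q 0"
    by (auto simp: eventually_at dist_real_def)
  have "q t \<le> q 0" if "\<bar>0 - t\<bar> < b" for t
    using b(2)[of t] that by (cases "t = 0") auto
  then show ?thesis using DERIV_local_max[OF q b(1)] by blast
qed

text \<open>
  Freezing the point \<open>x\<close> in the joint local representation of the action gives the local
  representation of the orbit map through \<open>x\<close>. Its differential is thus the restriction of the joint
  differential to vectors \<open>(w, 0)\<close>, which by the \<open>C\<^sup>1\<close> condition is continuous also in \<open>x\<close>.
\<close>

lemma orbit_map_derivative_continuous:
  fixes M :: "('g, 'e::euclidean_space) manifold"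
    and \<theta> :: "'g \<Rightarrow> 'a::euclidean_space \<Rightarrow> 'a"
  assumes k: "k \<ge> 1" and M: "ck_manifold k M" and \<theta>: "smooth_action k G M \<theta>"
    and c: "(U, \<phi>) \<in> atlas M" and p: "p \<in> U"
  defines "S \<equiv> \<phi> ` U"
  shows "((\<lambda>g. \<theta> g x) \<circ> inv_into U \<phi>) differentiable (at (\<phi> p) within S)"
    and "w \<in> model M \<Longrightarrow>
      continuous_on UNIV (\<lambda>x. frechet_derivative ((\<lambda>g. \<theta> g x) \<circ> inv_into U \<phi>) (at (\<phi> p) within S) w)"
proof -
  let ?A = "\<lambda>x. (\<lambda>g. \<theta> g x) \<circ> inv_into U \<phi>"
  define \<Psi> where "\<Psi> = (\<lambda>(g, x). \<theta> g x) \<circ> inv_into (U \<times> UNIV) (map_prod \<phi> id)"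
  have inj: "inj_on \<phi> U" using ck_manifold_chart_inj_on[OF M c] .
  have \<Psi>: "\<Psi> (u, x) = ?A x u" if "u \<in> S" for u x
  proof -
    have "inj_on (map_prod \<phi> id) (U \<times> (UNIV :: 'a set))"
      using inj by (intro map_prod_inj_on) auto
    moreover have "(u, x) = map_prod \<phi> id (inv_into U \<phi> u, x)" "inv_into U \<phi> u \<in> U"
      using that by (auto simp: S_def f_inv_into_f inv_into_into)
    ultimately have "inv_into (U \<times> UNIV) (map_prod \<phi> id) (u, x) = (inv_into U \<phi> u, x)"
      by (intro inv_into_f_eq) auto
    then show ?thesis by (simp add: \<Psi>_def)
  qed
  have "ck_map k (prod_manifold M euclidean_manifold) euclidean_manifold (\<lambda>(g, x). \<theta> g x)"
    using \<theta> by (simp add: smooth_action_def)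
  moreover have "(U \<times> UNIV, map_prod \<phi> id) \<in> atlas (prod_manifold M euclidean_manifold)"
    using c by (auto simp: prod_manifold_def euclidean_manifold_def)
  moreover have "(UNIV, id) \<in> atlas euclidean_manifold" by (simp add: euclidean_manifold_def)
  ultimately have "ck_on (model (prod_manifold M euclidean_manifold)) k
      (map_prod \<phi> id ` {p \<in> U \<times> UNIV. (case p of (g, x) \<Rightarrow> \<theta> g x) \<in> UNIV})
      (id \<circ> (\<lambda>(g, x). \<theta> g x) \<circ> inv_into (U \<times> UNIV) (map_prod \<phi> id))"
    unfolding ck_map_def by blast
  moreover have "map_prod \<phi> id ` (U \<times> (UNIV :: 'a set)) = S \<times> UNIV"
    by (force simp: S_def)
  ultimately have "ck_on (model M \<times> UNIV) k (S \<times> UNIV) \<Psi>"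
    by (simp add: \<Psi>_def prod_manifold_def euclidean_manifold_def o_assoc)
  then have ck: "ck_nat_on (model M \<times> UNIV) (Suc 0) (S \<times> UNIV) \<Psi>"
    using k unfolding ck_on_def one_enat_def One_nat_def by blast
  define D where "D z = frechet_derivative \<Psi> (at z within S \<times> UNIV)" for z
  have u: "\<phi> p \<in> S" using p by (simp add: S_def)
  have A: "(?A x has_derivative (\<lambda>h. D (\<phi> p, x) (h, 0))) (at (\<phi> p) within S)" for x
  proof -
    have "(\<Psi> has_derivative D (\<phi> p, x)) (at (\<phi> p, x) within S \<times> UNIV)"
      using ck u by (simp add: D_def frechet_derivative_works)
    then have "(\<Psi> has_derivative D (\<phi> p, x)) (at (\<phi> p, x) within (\<lambda>u. (u, x)) ` S)"
      by (rule has_derivative_subset) auto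
    moreover have "((\<lambda>u. (u, x)) has_derivative (\<lambda>h. (h, 0))) (at (\<phi> p) within S)"
      by (intro has_derivative_Pair has_derivative_ident has_derivative_const)
    ultimately have "((\<lambda>u. \<Psi> (u, x)) has_derivative (\<lambda>h. D (\<phi> p, x) (h, 0))) (at (\<phi> p) within S)"
      by (rule has_derivative_in_compose[rotated])
    then show ?thesis by (rule has_derivative_transform[OF u, rotated]) (simp add: \<Psi>)
  qed
  then show "?A x differentiable (at (\<phi> p) within S)" for x
    unfolding differentiable_def by blast
  assume w: "w \<in> model M"
  have "frechet_derivative (?A x) (at (\<phi> p) within S) w = D (\<phi> p, x) (w, 0)" for x
  proof (rule derivative_unique_on_subspace[OF _ _ u w _ A])
    show "subspace (model M)" using M by (simp add: ck_manifold_def)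
    show "openin (top_of_set (model M)) S" unfolding S_def using ck_manifold_chartD[OF M c] by simp
    show "(?A x has_derivative frechet_derivative (?A x) (at (\<phi> p) within S)) (at (\<phi> p) within S)"
      using A frechet_derivative_works differentiable_def by blast
  qed
  moreover have "continuous_on UNIV (\<lambda>x. D (\<phi> p, x) (w, 0))"
  proof (rule continuous_on_compose2[where g = "\<lambda>z. D z (w, 0)"])
    show "continuous_on (S \<times> UNIV) (\<lambda>z. D z (w, 0))" using ck w by (simp add: D_def)
    show "continuous_on UNIV (Pair (\<phi> p))" by (intro continuous_intros)
  qed (use u in auto)
  ultimately show "continuous_on UNIV (\<lambda>x. frechet_derivative (?A x) (at (\<phi> p) within S) w)"
    by simp
qed

text \<open>
  The straight segment \<open>t \<mapsto> \<phi> \<one> + t w\<close> in a chart around the identity is carried by the orbit map to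
  a curve in the orbit of \<open>x\<close>, on which an invariant function is constant.
\<close>

lemma regular_subgradient_orthogonal_orbit:
  fixes M :: "('g, 'e::euclidean_space) manifold"
    and \<theta> :: "'g \<Rightarrow> 'a::euclidean_space \<Rightarrow> 'a"
  assumes k: "k \<ge> 1" and G: "lie_group k G M" and \<theta>: "smooth_action k G M \<theta>"
    and inv: "\<And>g x. g \<in> carrier G \<Longrightarrow> f (\<theta> g x) = f x"
    and c: "(U, \<phi>) \<in> atlas M" and p: "\<one>\<^bsub>G\<^esub> \<in> U" and w: "w \<in> model M"
    and v: "v \<in> regular_subdifferential f x"
  shows "v \<bullet> frechet_derivative ((\<lambda>g. \<theta> g x) \<circ> inv_into U \<phi>) (at (\<phi> \<one>\<^bsub>G\<^esub>) within \<phi> ` U) w = 0"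
proof -
  let ?A = "(\<lambda>g. \<theta> g x) \<circ> inv_into U \<phi>" and ?u = "\<phi> \<one>\<^bsub>G\<^esub>" and ?S = "\<phi> ` U"
  let ?D = "frechet_derivative ?A (at ?u within ?S)"
  let ?l = "\<lambda>t::real. ?u + t *\<^sub>R w"
  have M: "ck_manifold k M" and UG: "U \<subseteq> carrier G"
    using G openin_subset[OF ck_manifold_chartD(1)[OF _ c]] by (auto simp: lie_group_def)
  have E: "subspace (model M)" using M by (simp add: ck_manifold_def)
  have oS: "openin (top_of_set (model M)) ?S" using ck_manifold_chartD[OF M c] by simp
  have uS: "?u \<in> ?S" using p by simp
  obtain O' where O': "open O'" "?S = model M \<inter> O'" using oS by (auto simp: openin_open)
  define T where "T = ?l -` O'"
  have oT: "open T"
    unfolding T_def by (intro open_vimage O'(1) continuous_intros)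
  have T0: "0 \<in> T" using uS O'(2) by (simp add: T_def)
  have lS: "?l t \<in> ?S" if "t \<in> T" for t
    using that uS w E O'(2) by (simp add: T_def subspace_add subspace_scale)
  have A: "(?A has_derivative ?D) (at ?u within ?S)"
    using orbit_map_derivative_continuous(1)[OF k M \<theta> c p] frechet_derivative_works by blast
  then have lin: "linear ?D" by (rule has_derivative_linear)
  have A': "(?A has_derivative ?D) (at (?l 0) within ?l ` T)"
    using A lS by (auto intro: has_derivative_subset)
  have line: "(?l has_derivative (\<lambda>t. t *\<^sub>R w)) (at 0 within T)"
    by (auto intro!: derivative_eq_intros)
  have "((\<lambda>t. ?A (?l t)) has_derivative (\<lambda>t. ?D (t *\<^sub>R w))) (at 0 within T)"
    by (rule has_derivative_in_compose[OF line A'])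
  then have der: "((\<lambda>t. ?A (?l t)) has_vector_derivative ?D w) (at 0)"
    using at_within_open[OF T0 oT] lin
    by (simp add: has_vector_derivative_def linear_scale)
  have "\<theta> \<one>\<^bsub>G\<^esub> = (\<lambda>x\<in>UNIV. x)"
    using \<theta> group_action.id_eq_one[of G UNIV \<theta>] by (simp add: smooth_action_def)
  then have x: "?A (?l 0) = x"
    using ck_manifold_chart_inj_on[OF M c] p by simp
  have "f (?A (?l t)) = f x" if "t \<in> T" for t
    using inv[of "inv_into U \<phi> (?l t)" x] lS[OF that] UG inv_into_into[of "?l t" \<phi> U] by auto
  then have "\<forall>\<^sub>F t in at 0. f (?A (?l t)) \<le> f (?A (?l 0))"
    using eventually_at_in_open'[OF oT T0] unfolding x by (auto elim: eventually_mono)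
  then show ?thesis
    using regular_subgradient_orthogonal_curve[OF _ der] v unfolding x by blast
qed

lemma limiting_subgradient_orthogonal_orbit_tangent_space:
  fixes M :: "('g, 'e::euclidean_space) manifold"
    and \<theta> :: "'g \<Rightarrow> 'a::euclidean_space \<Rightarrow> 'a"
  assumes k: "k \<ge> 1" and G: "lie_group k G M" and \<theta>: "smooth_action k G M \<theta>"
    and inv: "\<And>g x. g \<in> carrier G \<Longrightarrow> f (\<theta> g x) = f x"
    and v: "v \<in> limiting_subdifferential f x" and b: "b \<in> orbit_tangent_space G M \<theta> x"
  shows "orthogonal v b"
proof -
  have M: "ck_manifold k M" using G by (simp add: lie_group_def)
  obtain U \<phi> w where c: "(U, \<phi>) \<in> atlas M" and p: "\<one>\<^bsub>G\<^esub> \<in> U" and w: "w \<in> model M"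
    and b: "b = frechet_derivative ((\<lambda>g. \<theta> g x) \<circ> inv_into U \<phi>) (at (\<phi> \<one>\<^bsub>G\<^esub>) within \<phi> ` U) w"
    using b unfolding orbit_tangent_space_def differential_image_def differential_image_in_chart_def
    by auto
  define d where
    "d y = frechet_derivative ((\<lambda>g. \<theta> g y) \<circ> inv_into U \<phi>) (at (\<phi> \<one>\<^bsub>G\<^esub>) within \<phi> ` U) w" for y
  obtain X V where V: "\<And>j. V j \<in> regular_subdifferential f (X j)" and X: "X \<longlonglongrightarrow> x"
    and Vv: "V \<longlonglongrightarrow> v"
    using v unfolding limiting_subdifferential_def by blast
  have "isCont d x"
    using orbit_map_derivative_continuous(2)[OF k M \<theta> c p w]
    by (simp add: d_def[abs_def] continuous_on_eq_continuous_at)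
  then have "(\<lambda>j. d (X j)) \<longlonglongrightarrow> d x" using X by (rule isCont_tendsto_compose)
  with Vv have "(\<lambda>j. V j \<bullet> d (X j)) \<longlonglongrightarrow> v \<bullet> d x" by (rule tendsto_inner)
  moreover have "V j \<bullet> d (X j) = 0" for j
    unfolding d_def by (rule regular_subgradient_orthogonal_orbit[OF k G \<theta> inv c p w V])
  ultimately have "v \<bullet> d x = 0" using LIMSEQ_unique[OF _ tendsto_const] by simp
  then show ?thesis by (simp add: b d_def orthogonal_def)
qed

lemma zero_in_orbit_tangent_space:
  fixes M :: "('g, 'e::euclidean_space) manifold"
    and \<theta> :: "'g \<Rightarrow> 'a::euclidean_space \<Rightarrow> 'a"
  assumes k: "k \<ge> 1" and G: "lie_group k G M" and \<theta>: "smooth_action k G M \<theta>"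
  shows "0 \<in> orbit_tangent_space G M \<theta> x"
proof -
  have M: "ck_manifold k M" and "\<one>\<^bsub>G\<^esub> \<in> topspace (mtop M)"
    using G group.is_monoid monoid.one_closed by (auto simp: lie_group_def)
  then have "\<one>\<^bsub>G\<^esub> \<in> \<Union> (fst ` atlas M)" by (simp add: ck_manifold_def)
  then obtain U \<phi> where c: "(U, \<phi>) \<in> atlas M" and p: "\<one>\<^bsub>G\<^esub> \<in> U" by auto
  let ?D = "frechet_derivative ((\<lambda>g. \<theta> g x) \<circ> inv_into U \<phi>) (at (\<phi> \<one>\<^bsub>G\<^esub>) within \<phi> ` U)"
  have "linear ?D"
    using orbit_map_derivative_continuous(1)[OF k M \<theta> c p] linear_frechet_derivative by blast
  then have "?D 0 = 0" by (rule linear_0)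
  moreover have "0 \<in> model M" using M by (simp add: ck_manifold_def subspace_0)
  ultimately have "0 \<in> differential_image_in_chart M (U, \<phi>) (\<lambda>g. \<theta> g x) \<one>\<^bsub>G\<^esub>"
    unfolding differential_image_in_chart_def by force
  then show ?thesis
    using c p unfolding orbit_tangent_space_def differential_image_def by force
qed

lemma orthogonal_projection_eq_0:
  assumes "0 \<in> V" and "\<And>w. w \<in> V \<Longrightarrow> orthogonal s w"
  shows "orthogonal_projection V s = 0"
  unfolding orthogonal_projection_def
proof (rule the_equality)
  fix p assume p: "p \<in> V \<and> (\<forall>w\<in>V. orthogonal (s - p) w)"
  then have "(s - p) \<bullet> p = 0" and "s \<bullet> p = 0" using assms(2) by (auto simp: orthogonal_def)
  then show "p = 0" by (simp add: inner_diff_left)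
qed (use assms in auto)

theorem proposition3:
  fixes k :: enat
    and G :: "('g, 'm) monoid_scheme"
    and M :: "('g, 'e::euclidean_space) manifold"
    and \<theta> :: "'g \<Rightarrow> real ^ 'n \<Rightarrow> real ^ 'n"
    and f :: "real ^ 'n \<Rightarrow> ereal"
    and xbar :: "real ^ 'n"
  assumes "k \<ge> 1"
    and "lie_group k G M"
    and "smooth_action k G M \<theta>"
    and "\<And>x. f x \<noteq> -\<infinity>"
    and "\<And>g x. g \<in> carrier G \<Longrightarrow> f (\<theta> g x) = f x"
    and "xbar \<in> interior (effective_domain f)"
    and "lipschitz_near f xbar"
  shows "orthogonal_projection (orbit_tangent_space G M \<theta> xbar) ` limiting_subdifferential f xbar = {0}"
proof -
  have "orthogonal_projection (orbit_tangent_space G M \<theta> xbar) v = 0"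
    if "v \<in> limiting_subdifferential f xbar" for v
    using zero_in_orbit_tangent_space[OF assms(1-3)]
      limiting_subgradient_orthogonal_orbit_tangent_space[OF assms(1-3,5) that]
    by (rule orthogonal_projection_eq_0)
  moreover have "limiting_subdifferential f xbar \<noteq> {}"
    by (rule limiting_subdifferential_nonempty[OF assms(4,6,7)])
  ultimately show ?thesis by force
qed

end
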